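(* Let $K$ be a field, let $I$ be an ideal of $K[X]$ and let $J$ be a proper radical ideal of $K[X]$. Then the following conditions are equivalent: (A) $\mathrm{Ass}(J)\subset \mathrm{Ass}(I)$; (B) $J\supset (I:(I:J))$; (C) $J\supset (I:(I:J^{\infty}))$.
   Context: $X=\{x_1,\ldots,x_n\}$ is a finite set of variables. For ideals $A,B$, $(A:B)=\{f\mid fB\subset A\}$ and $(A:B^\infty)=\bigcup_{m\ge 1}(A:B^m)$. $\mathrm{Ass}(I)$ denotes the set of prime divisors of $I$, i.e. the primes $\sqrt{Q}$ where $Q$ runs over the components of an irredundant primary decomposition of $I$. *)

theory Defs
  imports "HOL-Algebra.Ideal_Product" "HOL-Library.Poly_Mapping"
begin

text \<open>Polynomials with coefficients in \<^typ>\<open>'k\<close> are finitely supported maps from monomials to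
  coefficients, where a monomial is a finitely supported map from variables to exponents; the
  product of \<^theory>\<open>HOL-Library.Poly_Mapping\<close> is the convolution product. The carrier of
  \<open>mpoly_ring X\<close> consists of the polynomials in which only variables from \<open>X\<close> occur.\<close>

definition mpoly_ring :: "'x set \<Rightarrow> (('x \<Rightarrow>\<^sub>0 nat) \<Rightarrow>\<^sub>0 'k::field) ring" where
  "mpoly_ring X =
     \<lparr>carrier = {p. \<forall>m \<in> Poly_Mapping.keys p. Poly_Mapping.keys m \<subseteq> X},
      mult = (*), one = 1, zero = 0, add = (+)\<rparr>"

lemma keys_mpoly_mult:
  fixes p q :: "('x \<Rightarrow>\<^sub>0 nat) \<Rightarrow>\<^sub>0 'k::field"
  assumes "\<forall>m \<in> Poly_Mapping.keys p. Poly_Mapping.keys m \<subseteq> X"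
    and "\<forall>m \<in> Poly_Mapping.keys q. Poly_Mapping.keys m \<subseteq> X"
  shows "\<forall>m \<in> Poly_Mapping.keys (p * q). Poly_Mapping.keys m \<subseteq> X"
proof
  fix m assume "m \<in> Poly_Mapping.keys (p * q)"
  then obtain a b where "a \<in> Poly_Mapping.keys p" "b \<in> Poly_Mapping.keys q" "m = a + b"
    using keys_mult[of p q] by blast
  then show "Poly_Mapping.keys m \<subseteq> X"
    using assms Poly_Mapping.keys_add[of a b] by blast
qed

lemma keys_mpoly_add:
  fixes p q :: "('x \<Rightarrow>\<^sub>0 nat) \<Rightarrow>\<^sub>0 'k::field"
  assumes "\<forall>m \<in> Poly_Mapping.keys p. Poly_Mapping.keys m \<subseteq> X"
    and "\<forall>m \<in> Poly_Mapping.keys q. Poly_Mapping.keys m \<subseteq> X"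
  shows "\<forall>m \<in> Poly_Mapping.keys (p + q). Poly_Mapping.keys m \<subseteq> X"
  using assms Poly_Mapping.keys_add[of p q] by blast

lemma cring_mpoly_ring:
  fixes X :: "'x set"
  shows "cring (mpoly_ring X :: (('x \<Rightarrow>\<^sub>0 nat) \<Rightarrow>\<^sub>0 'k::field) ring)"
    (is "cring ?R")
proof (rule cringI)
  show "abelian_group ?R"
  proof (rule abelian_groupI)
    fix p assume "p \<in> carrier ?R"
    then have "- p \<in> carrier ?R" and "- p \<oplus>\<^bsub>?R\<^esub> p = \<zero>\<^bsub>?R\<^esub>"
      unfolding mpoly_ring_def by simp_all
    then show "\<exists>q \<in> carrier ?R. q \<oplus>\<^bsub>?R\<^esub> p = \<zero>\<^bsub>?R\<^esub>"
      by blast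
  next
    fix p q assume "p \<in> carrier ?R" and "q \<in> carrier ?R"
    then show "p \<oplus>\<^bsub>?R\<^esub> q \<in> carrier ?R"
      using keys_mpoly_add[of p X q] unfolding mpoly_ring_def by simp
  qed (simp_all add: mpoly_ring_def add.assoc add.commute)
  show "comm_monoid ?R"
  proof (rule comm_monoidI)
    fix p q assume "p \<in> carrier ?R" and "q \<in> carrier ?R"
    then show "p \<otimes>\<^bsub>?R\<^esub> q \<in> carrier ?R"
      using keys_mpoly_mult[of p X q] unfolding mpoly_ring_def by simp
  qed (simp_all add: mpoly_ring_def mult.assoc mult.commute)
qed (simp add: mpoly_ring_def distrib_right)

definition ideal_quotient :: "('a, 'b) ring_scheme \<Rightarrow> 'a set \<Rightarrow> 'a set \<Rightarrow> 'a set" where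
  "ideal_quotient R A B = {f \<in> carrier R. \<forall>b \<in> B. f \<otimes>\<^bsub>R\<^esub> b \<in> A}"

primrec ideal_power :: "('a, 'b) ring_scheme \<Rightarrow> 'a set \<Rightarrow> nat \<Rightarrow> 'a set" where
  "ideal_power R A 0 = carrier R"
| "ideal_power R A (Suc m) = A \<cdot>\<^bsub>R\<^esub> ideal_power R A m"

definition ideal_saturation :: "('a, 'b) ring_scheme \<Rightarrow> 'a set \<Rightarrow> 'a set \<Rightarrow> 'a set" where
  "ideal_saturation R A B = (\<Union>m \<in> {1::nat..}. ideal_quotient R A (ideal_power R B m))"

definition radical :: "('a, 'b) ring_scheme \<Rightarrow> 'a set \<Rightarrow> 'a set" where
  "radical R A = {f \<in> carrier R. \<exists>n::nat. n \<ge> 1 \<and> f [^]\<^bsub>R\<^esub> n \<in> A}"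

definition radical_ideal :: "'a set \<Rightarrow> ('a, 'b) ring_scheme \<Rightarrow> bool" where
  "radical_ideal A R \<longleftrightarrow> ideal A R \<and> radical R A = A"

definition primary_ideal :: "'a set \<Rightarrow> ('a, 'b) ring_scheme \<Rightarrow> bool" where
  "primary_ideal Q R \<longleftrightarrow> ideal Q R \<and> Q \<noteq> carrier R \<and>
     (\<forall>a \<in> carrier R. \<forall>b \<in> carrier R. a \<otimes>\<^bsub>R\<^esub> b \<in> Q \<longrightarrow> a \<in> Q \<or> b \<in> radical R Q)"

text \<open>The intersection of the empty family of ideals is the whole ring, so the empty set is the
  irredundant primary decomposition of the unit ideal.\<close>

definition irredundant_primary_decomposition ::
    "('a, 'b) ring_scheme \<Rightarrow> 'a set \<Rightarrow> 'a set set \<Rightarrow> bool" where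
  "irredundant_primary_decomposition R A \<Q> \<longleftrightarrow>
     finite \<Q> \<and> (\<forall>Q \<in> \<Q>. primary_ideal Q R) \<and> carrier R \<inter> \<Inter>\<Q> = A \<and>
     inj_on (radical R) \<Q> \<and> (\<forall>Q \<in> \<Q>. \<not> carrier R \<inter> \<Inter>(\<Q> - {Q}) \<subseteq> Q)"

text \<open>The set of radicals of the components is the same for all irredundant primary
  decompositions of an ideal, so it does not matter which one is used.\<close>

definition Ass :: "('a, 'b) ring_scheme \<Rightarrow> 'a set \<Rightarrow> 'a set set" where
  "Ass R A = {P. \<exists>\<Q>. irredundant_primary_decomposition R A \<Q> \<and> P \<in> radical R ` \<Q>}"

end

theory Submission
  imports Defs "HOL-Algebra.Ring_Divisibility"
begin

text \<open>Everything happens in a Noetherian commutative ring. If \<open>P = \<surd>Q \<supseteq> J\<close> for a component \<open>Q\<close> of \<open>I\<close>,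
  then some \<open>a \<notin> Q\<close> lies in \<open>(I : J)\<close>, and \<open>fa \<in> I\<close> forces \<open>f \<in> P\<close>; since a radical ideal is the
  intersection of its associated primes, (A) implies (B). Now assume (C), let \<open>P\<close> be a prime divisor of
  \<open>J\<close>, and let \<open>N\<close> be the intersection of the components \<open>Q\<close> of \<open>I\<close> with \<open>J \<subseteq> \<surd>Q\<close>. The other components
  contain \<open>(I : J\<^sup>\<infinity>)\<close>, so \<open>N \<subseteq> (I : (I : J\<^sup>\<infinity>)) \<subseteq> J \<subseteq> P\<close>. Hence \<open>J \<subseteq> \<surd>Q \<subseteq> P\<close> for one of the components
  of \<open>N\<close>, and \<open>\<surd>Q = P\<close> because \<open>P\<close> is minimal over the radical ideal \<open>J\<close>.\<close>

section \<open>Ideals in Noetherian rings\<close>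

text \<open>Negatives arise as multiples by \<open>\<ominus> \<one>\<close>, and commutativity turns
  left multiples into right multiples.\<close>

lemma (in cring) cring_idealI:
  assumes "A \<subseteq> carrier R" and "\<zero> \<in> A"
    and "\<And>a b. a \<in> A \<Longrightarrow> b \<in> A \<Longrightarrow> a \<oplus> b \<in> A"
    and mult: "\<And>a r. a \<in> A \<Longrightarrow> r \<in> carrier R \<Longrightarrow> r \<otimes> a \<in> A"
  shows "ideal A R"
proof (rule idealI)
  show "ring R" by (rule ring_axioms)
  show "subgroup A (add_monoid R)"
  proof (rule add.subgroupI)
    fix a assume a: "a \<in> A"
    then have "\<ominus> a = (\<ominus> \<one>) \<otimes> a"
      using assms(1) by (metis l_minus l_one one_closed subsetD)
    then show "\<ominus> a \<in> A"
      using mult[OF a, of "\<ominus> \<one>"] by simp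
  qed (use assms in auto)
  fix a r assume a: "a \<in> A" and r: "r \<in> carrier R"
  then show "r \<otimes> a \<in> A"
    by (rule mult)
  then show "a \<otimes> r \<in> A"
    using a r assms(1) m_comm by (metis subsetD)
qed

text \<open>The colon ideal (A : b) of a single element; the maximality arguments for primary
  decompositions and for associated primes run over ideals of this kind.\<close>

lemma (in cring) ideal_elem_quotient:
  assumes "ideal A R" and b: "b \<in> carrier R"
  shows "ideal {r \<in> carrier R. r \<otimes> b \<in> A} R"
proof -
  interpret A: ideal A R by fact
  show ?thesis
  proof (rule cring_idealI)
    fix r s assume "r \<in> {r \<in> carrier R. r \<otimes> b \<in> A}" "s \<in> carrier R"
    then show "s \<otimes> r \<in> {r \<in> carrier R. r \<otimes> b \<in> A}"
      using b A.I_l_closed by (auto simp: m_assoc)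
  qed (use b in \<open>auto simp: l_distr A.zero_closed\<close>)
qed

text \<open>Zorn's lemma applies because a nonempty chain of ideals contains its own union. In this
  form the Noetherian hypothesis enters most arguments below.\<close>

lemma (in noetherian_ring) exists_maximal_ideal_in:
  assumes "S \<noteq> {}" and S: "\<And>I. I \<in> S \<Longrightarrow> ideal I R"
  shows "\<exists>M\<in>S. \<forall>I\<in>S. M \<subseteq> I \<longrightarrow> I = M"
proof (rule subset_Zorn)
  fix C assume C: "subset.chain S C"
  show "\<exists>U\<in>S. \<forall>I\<in>C. I \<subseteq> U"
  proof (cases "C = {}")
    case True
    with assms(1) show ?thesis by auto
  next
    case False
    moreover have "subset.chain {I. ideal I R} C"
      using C S unfolding pred_on.chain_def by blast
    ultimately have "\<Union>C \<in> C"
      by (rule ideal_chain_is_trivial)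
    moreover have "C \<subseteq> S"
      using C unfolding pred_on.chain_def by blast
    ultimately have "\<Union>C \<in> S"
      by (rule rev_subsetD)
    then show ?thesis
      by (rule rev_bexI) auto
  qed
qed

section \<open>Primary decomposition\<close>

lemma radical_mono: "A \<subseteq> B \<Longrightarrow> radical R A \<subseteq> radical R B"
  unfolding radical_def by blast

lemma radical_subset_carrier: "radical R A \<subseteq> carrier R"
  unfolding radical_def by blast

lemma primary_idealD: "primary_ideal Q R \<Longrightarrow> ideal Q R"
  unfolding primary_ideal_def by blast

lemma ideal_quotient_antimono: "B \<subseteq> C \<Longrightarrow> ideal_quotient R A C \<subseteq> ideal_quotient R A B"
  unfolding ideal_quotient_def by blast

context cring
begin

lemma nat_pow_mem_ideal_mono:
  assumes "ideal A R" "a \<in> carrier R" "a [^] n \<in> A" "(n::nat) \<le> m"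
  shows "a [^] m \<in> A"
proof -
  have "a [^] m = a [^] (m - n) \<otimes> a [^] n"
    using assms by (simp add: nat_pow_mult)
  then show ?thesis
    using assms ideal.I_l_closed nat_pow_closed by metis
qed

lemma subset_radical:
  assumes "ideal A R"
  shows "A \<subseteq> radical R A"
proof
  fix a assume "a \<in> A"
  moreover from this have "a \<in> carrier R"
    using assms ideal.Icarr by metis
  ultimately show "a \<in> radical R A"
    unfolding radical_def by (auto intro!: exI[of _ 1])
qed

lemma nat_pow_mem_radical:
  assumes "a \<in> carrier R" "a [^] n \<in> radical R A" "(n::nat) \<ge> 1"
  shows "a \<in> radical R A"
proof -
  obtain m :: nat where "m \<ge> 1" "a [^] (n * m) \<in> A"
    using assms unfolding radical_def by (auto simp: nat_pow_pow)
  moreover from this have "n * m \<ge> 1"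
    using assms(3) by simp
  ultimately show ?thesis
    using assms(1) unfolding radical_def by blast
qed

lemma radical_radical: "radical R (radical R A) \<subseteq> radical R A"
proof
  fix a assume "a \<in> radical R (radical R A)"
  then obtain n :: nat where "a \<in> carrier R" "a [^] n \<in> radical R A" "n \<ge> 1"
    unfolding radical_def[of R "radical R A"] by blast
  then show "a \<in> radical R A"
    by (rule nat_pow_mem_radical)
qed

lemma radical_Int:
  assumes "ideal A R" "ideal B R"
  shows "radical R (A \<inter> B) = radical R A \<inter> radical R B"
proof
  show "radical R (A \<inter> B) \<subseteq> radical R A \<inter> radical R B"
    by (simp add: radical_mono)
  show "radical R A \<inter> radical R B \<subseteq> radical R (A \<inter> B)"
  proof
    fix a assume "a \<in> radical R A \<inter> radical R B"
    then obtain n m :: nat where nm: "n \<ge> 1" "m \<ge> 1" "a [^] n \<in> A" "a [^] m \<in> B"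
      and a: "a \<in> carrier R"
      unfolding radical_def by blast
    then have "a [^] (n + m) \<in> A \<inter> B"
      using assms nat_pow_mem_ideal_mono by auto
    with nm a show "a \<in> radical R (A \<inter> B)"
      unfolding radical_def by (auto intro!: exI[of _ "n + m"])
  qed
qed

section \<open>Radicals of primary ideals as primes\<close>

lemma one_notin_radical_primary:
  assumes "primary_ideal Q R"
  shows "\<one> \<notin> radical R Q"
proof
  assume "\<one> \<in> radical R Q"
  then have "\<one> \<in> Q"
    unfolding radical_def by simp
  then show False
    using assms ideal.one_imp_carrier[of Q R] unfolding primary_ideal_def by blast
qed

text \<open>The primary condition is applied to the factors a^n and b^n of (ab)^n; a power lying in
  \<surd>Q puts its base there too.\<close>

lemma radical_primary_prime:
  assumes Q: "primary_ideal Q R" and ab: "a \<in> carrier R" "b \<in> carrier R"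
    and "a \<otimes> b \<in> radical R Q"
  shows "a \<in> radical R Q \<or> b \<in> radical R Q"
proof -
  obtain n :: nat where n: "n \<ge> 1" "a [^] n \<otimes> b [^] n \<in> Q"
    using assms unfolding radical_def by (auto simp: nat_pow_distrib)
  then have "a [^] n \<in> Q \<or> b [^] n \<in> radical R Q"
    using Q ab unfolding primary_ideal_def by blast
  then show ?thesis
  proof
    assume "a [^] n \<in> Q"
    with n ab show ?thesis unfolding radical_def by blast
  next
    assume "b [^] n \<in> radical R Q"
    with n ab show ?thesis using nat_pow_mem_radical by blast
  qed
qed

text \<open>A product of elements, one from each member and all outside the prime \<surd>Q, would
  lie in the intersection but not in \<surd>Q. The product argument rests on closure under
  multiples, so this is what is assumed of the members. For the empty family the witness is
  1.\<close>

lemma Inter_subset_radical_primary: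
  assumes Q: "primary_ideal Q R" and "finite \<S>"
    and \<S>: "\<And>S. S \<in> \<S> \<Longrightarrow> S \<subseteq> carrier R"
      "\<And>S r s. S \<in> \<S> \<Longrightarrow> s \<in> S \<Longrightarrow> r \<in> carrier R \<Longrightarrow> r \<otimes> s \<in> S"
    and sub: "carrier R \<inter> \<Inter>\<S> \<subseteq> radical R Q"
  shows "\<exists>S\<in>\<S>. S \<subseteq> radical R Q"
proof (rule ccontr)
  assume contra: "\<not> ?thesis"
  have "\<exists>x\<in>carrier R \<inter> \<Inter>\<S>. x \<notin> radical R Q"
    using \<open>finite \<S>\<close> \<S> contra
  proof induction
    case empty
    then show ?case using one_notin_radical_primary[OF Q] by auto
  next
    case (insert S \<S>)
    obtain x where x: "x \<in> carrier R \<inter> \<Inter>\<S>" "x \<notin> radical R Q"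
      using insert.IH insert.prems by (metis insert_iff)
    obtain y where y: "y \<in> S" "y \<notin> radical R Q"
      using insert.prems(3) by blast
    have carr: "x \<in> carrier R" "y \<in> carrier R"
      using x(1) y(1) insert.prems(1)[of S] by auto
    have "x \<otimes> y \<notin> radical R Q"
      using radical_primary_prime[OF Q] carr x y by blast
    moreover have "x \<otimes> y \<in> carrier R \<inter> \<Inter>(insert S \<S>)"
    proof -
      have "x \<otimes> y \<in> T" if "T \<in> \<S>" for T
        using that x carr insert.prems(2)[of T x y] by (auto simp: m_comm)
      then show ?thesis
        using carr insert.prems(2)[of S y x] y by auto
    qed
    ultimately show ?case by blast
  qed
  with sub show False by blast
qed

text \<open>Radicals commute with finite intersections, so all three ideals share one radical and
  the two primary conditions combine.\<close>

lemma primary_ideal_Int: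
  assumes Q: "primary_ideal Q R" "primary_ideal Q' R" and eq: "radical R Q = radical R Q'"
  shows "primary_ideal (Q \<inter> Q') R"
proof -
  have ideals: "ideal Q R" "ideal Q' R"
    using Q primary_idealD by blast+
  have rad: "radical R (Q \<inter> Q') = radical R Q" "radical R (Q \<inter> Q') = radical R Q'"
    using radical_Int[OF ideals] eq by auto
  have "Q \<inter> Q' \<noteq> carrier R"
    using Q(1) ideal.Icarr[OF ideals(1)] unfolding primary_ideal_def by blast
  moreover have "a \<in> Q \<inter> Q' \<or> b \<in> radical R (Q \<inter> Q')"
    if "a \<in> carrier R" "b \<in> carrier R" "a \<otimes> b \<in> Q \<inter> Q'" for a b
  proof -
    have "a \<in> Q \<or> b \<in> radical R Q" "a \<in> Q' \<or> b \<in> radical R Q'"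
      using Q that unfolding primary_ideal_def by blast+
    then show ?thesis
      using rad by blast
  qed
  ultimately show ?thesis
    using i_intersect[OF ideals] unfolding primary_ideal_def by blast
qed

section \<open>Existence of primary decompositions\<close>

text \<open>If \<open>ab \<in> A\<close> witnesses that \<open>A\<close> is not primary, then \<open>(A : b\<^sup>n)\<close> is constant for large
  \<open>n\<close>, and \<open>A = (A : b\<^sup>n) \<inter> (A + b\<^sup>n R)\<close> for such \<open>n\<close>.\<close>

lemma not_primary_imp_Int:
  assumes R: "noetherian_ring R" and A: "ideal A R" "A \<noteq> carrier R" "\<not> primary_ideal A R"
  obtains B C where "ideal B R" "ideal C R" "A \<subset> B" "A \<subset> C" "A = B \<inter> C"
proof -
  interpret A: ideal A R by fact
  obtain a b where ab: "a \<in> carrier R" "b \<in> carrier R" "a \<otimes> b \<in> A" "a \<notin> A" "b \<notin> radical R A"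
    using A unfolding primary_ideal_def by blast
  define D where "D n = {r \<in> carrier R. r \<otimes> b [^] n \<in> A}" for n :: nat
  have D_ideal: "ideal (D n) R" for n
    unfolding D_def using ideal_elem_quotient[OF A(1)] ab by simp
  have D_mono: "D n \<subseteq> D m" if "n \<le> m" for n m
  proof
    fix r assume r: "r \<in> D n"
    have "r \<otimes> b [^] m = b [^] (m - n) \<otimes> (r \<otimes> b [^] n)"
      using r ab that nat_pow_mult[of b "m - n" n]
      by (simp add: D_def m_ac flip: nat_pow_mult)
    then show "r \<in> D m"
      using r ab A.I_l_closed unfolding D_def by auto
  qed
  have "\<exists>M\<in>range D. \<forall>I\<in>range D. M \<subseteq> I \<longrightarrow> I = M"
    by (rule noetherian_ring.exists_maximal_ideal_in[OF R]) (auto simp: D_ideal)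
  then obtain n0 where n0: "\<And>m. D n0 \<subseteq> D m \<Longrightarrow> D m = D n0"
    by auto
  \<comment> \<open>One step past the stable index, so that n \<ge> 1: this gives b^n \<notin> A
    from b \<notin> \<surd>A, and a \<in> \<open>D 1\<close> \<subseteq> \<open>D n\<close>.\<close>
  define n where "n = Suc n0"
  have stable: "D (n + n) = D n"
    by (metis D_mono n0 le_add1 n_def plus_1_eq_Suc le_add2 order.trans)
  have bn: "b [^] n \<in> carrier R" "b [^] n \<notin> A"
    using ab unfolding radical_def n_def by auto
  define B where "B = A <+>\<^bsub>R\<^esub> PIdl (b [^] n)"
  have "ideal B R"
    unfolding B_def using A bn by (intro add_ideals cgenideal_ideal)
  moreover have "A \<subset> B"
  proof -
    have "A \<subseteq> B"
    proof
      fix x assume x: "x \<in> A"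
      have "\<zero> \<in> PIdl (b [^] n)"
        using cgenideal_ideal[OF bn(1)] by (simp add: additive_subgroup.zero_closed ideal.axioms(1))
      then have "x \<oplus> \<zero> \<in> B"
        unfolding B_def set_add_def' using x by blast
      then show "x \<in> B"
        using A.Icarr[OF x] by simp
    qed
    moreover have "b [^] n \<in> B"
    proof -
      have "\<zero> \<oplus> b [^] n \<in> B"
        unfolding B_def set_add_def' using cgenideal_self[OF bn(1)] A.zero_closed by blast
      then show ?thesis using bn(1) by simp
    qed
    ultimately show ?thesis using bn by blast
  qed
  moreover have "A \<subset> D n"
  proof -
    have "A \<subseteq> D n"
      unfolding D_def using A.I_r_closed A.Icarr bn by auto
    moreover have "a \<in> D 1"
      unfolding D_def using ab by simp
    ultimately show ?thesis
      using ab D_mono[of 1 n] unfolding n_def by auto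
  qed
  moreover have "A = B \<inter> D n"
  proof
    show "A \<subseteq> B \<inter> D n"
      using \<open>A \<subset> B\<close> \<open>A \<subset> D n\<close> by blast
    show "B \<inter> D n \<subseteq> A"
    proof
      fix x assume x: "x \<in> B \<inter> D n"
      then obtain i r where ir: "i \<in> A" "r \<in> carrier R" "x = i \<oplus> r \<otimes> b [^] n"
        unfolding B_def set_add_def' cgenideal_def by blast
      have i: "i \<in> carrier R" using ir A.Icarr by blast
      \<comment> \<open>Multiplying x = i + r b^n by b^n shows r b^(2n) \<in> A; stability then
        gives r b^n \<in> A, hence x \<in> A.\<close>
      have "x \<otimes> b [^] n = i \<otimes> b [^] n \<oplus> r \<otimes> b [^] (n + n)"
        using ir i ab(2) by (simp add: l_distr m_assoc nat_pow_mult)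
      then have "r \<otimes> b [^] (n + n) = \<ominus> (i \<otimes> b [^] n) \<oplus> x \<otimes> b [^] n"
        using ir(2) i ab(2) by (simp add: r_neg1)
      also have "\<dots> \<in> A"
        using x ir bn A.I_r_closed unfolding D_def by auto
      finally have "r \<in> D n"
        unfolding stable[symmetric] using ir by (simp add: D_def)
      with ir show "x \<in> A"
        unfolding D_def by auto
    qed
  qed
  ultimately show thesis
    using D_ideal that by blast
qed

text \<open>Noetherian induction: a maximal counterexample is not the whole ring (empty
  decomposition) and not primary (one component), so it is the intersection of two larger ideals,
  whose decompositions can be united.\<close>

lemma exists_primary_decomposition:
  assumes R: "noetherian_ring R" and "ideal A R"
  shows "\<exists>\<Q>. finite \<Q> \<and> (\<forall>Q\<in>\<Q>. primary_ideal Q R) \<and> carrier R \<inter> \<Inter>\<Q> = A"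
    (is "?dec A")
proof (rule ccontr)
  assume "\<not> ?dec A"
  define S where "S = {A. ideal A R \<and> \<not> ?dec A}"
  have S: "B \<in> S \<longleftrightarrow> ideal B R \<and> \<not> ?dec B" for B
    unfolding S_def by (rule mem_Collect_eq)
  have "\<exists>M\<in>S. \<forall>B\<in>S. M \<subseteq> B \<longrightarrow> B = M"
  proof (rule noetherian_ring.exists_maximal_ideal_in[OF R])
    have "A \<in> S" using S \<open>ideal A R\<close> \<open>\<not> ?dec A\<close> by blast
    then show "S \<noteq> {}" by blast
  qed (simp add: S)
  then obtain M where "M \<in> S" and max: "\<And>B. B \<in> S \<Longrightarrow> M \<subseteq> B \<Longrightarrow> B = M"
    by blast
  then have M: "ideal M R" "\<not> ?dec M"
    using S by blast+
  have "M \<noteq> carrier R"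
  proof
    assume "M = carrier R"
    then have "?dec M" by (intro exI[of _ "{}"]) simp
    with M show False by blast
  qed
  moreover have "\<not> primary_ideal M R"
  proof
    assume "primary_ideal M R"
    moreover have "M \<subseteq> carrier R"
      using ideal.Icarr[OF M(1)] by blast
    ultimately have "?dec M" by (intro exI[of _ "{M}"]) auto
    with M show False by blast
  qed
  ultimately obtain B C where BC: "ideal B R" "ideal C R" "M \<subset> B" "M \<subset> C" "M = B \<inter> C"
    using not_primary_imp_Int[OF R M(1)] by blast
  have "?dec B" using max[of B] BC S by blast
  then obtain \<Q> where 1: "finite \<Q>" "\<forall>Q\<in>\<Q>. primary_ideal Q R" "carrier R \<inter> \<Inter>\<Q> = B"
    by blast
  have "?dec C" using max[of C] BC S by blast
  then obtain \<Q>' where 2: "finite \<Q>'" "\<forall>Q\<in>\<Q>'. primary_ideal Q R" "carrier R \<inter> \<Inter>\<Q>' = C"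
    by blast
  have "?dec M"
    using 1 2 BC(5) by (intro exI[of _ "\<Q> \<union> \<Q>'"]) auto
  with M show False by blast
qed

text \<open>A primary decomposition with the least number of components is irredundant, since two
  components with the same radical could be replaced by their intersection.\<close>

lemma exists_irredundant_primary_decomposition:
  assumes R: "noetherian_ring R" and "ideal A R"
  obtains \<Q> where "irredundant_primary_decomposition R A \<Q>"
proof -
  define dec where
    "dec \<Q> \<longleftrightarrow> finite \<Q> \<and> (\<forall>Q\<in>\<Q>. primary_ideal Q R) \<and> carrier R \<inter> \<Inter>\<Q> = A" for \<Q>
  obtain \<Q> where \<Q>: "dec \<Q>" and least: "\<And>\<Q>'. dec \<Q>' \<Longrightarrow> card \<Q> \<le> card \<Q>'"
    using exists_primary_decomposition[OF assms] ex_has_least_nat[of dec _ card]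
    unfolding dec_def by metis
  have fin: "finite \<Q>" using \<Q> by (simp add: dec_def)
  have "\<not> carrier R \<inter> \<Inter>(\<Q> - {Q}) \<subseteq> Q" if "Q \<in> \<Q>" for Q
  proof
    \<comment> \<open>A redundant component could be dropped, against the minimal number of
      components.\<close>
    assume "carrier R \<inter> \<Inter>(\<Q> - {Q}) \<subseteq> Q"
    then have "carrier R \<inter> \<Inter>(\<Q> - {Q}) = carrier R \<inter> \<Inter>\<Q>"
      by blast
    then have "dec (\<Q> - {Q})"
      using \<Q> unfolding dec_def by auto
    then show False
      using least that fin by (metis card_Diff1_less not_less)
  qed
  moreover have "inj_on (radical R) \<Q>"
  proof (rule inj_onI, rule ccontr)
    fix Q Q' assume Q: "Q \<in> \<Q>" "Q' \<in> \<Q>" "radical R Q = radical R Q'" "Q \<noteq> Q'"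
    define \<Q>' where "\<Q>' = insert (Q \<inter> Q') (\<Q> - {Q, Q'})"
    have "\<Inter>\<Q>' = \<Inter>\<Q>"
      using Q unfolding \<Q>'_def by blast
    moreover have "primary_ideal (Q \<inter> Q') R"
      using Q \<Q> by (intro primary_ideal_Int) (auto simp: dec_def)
    ultimately have "dec \<Q>'"
      using \<Q> unfolding dec_def \<Q>'_def by auto
    then have "card \<Q> \<le> card \<Q>'" by (rule least)
    \<comment> \<open>The intersection may coincide with a remaining component, so there is only an
      upper bound: two components removed, at most one added.\<close>
    also have "\<dots> \<le> Suc (card (\<Q> - {Q, Q'}))"
      unfolding \<Q>'_def by (rule card_insert_le_m1) (use fin in auto)
    also have "\<dots> < card \<Q>"
    proof -
      have "card (\<Q> - {Q, Q'}) = card \<Q> - 2"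
        using Q fin by (simp add: card_Diff_subset)
      moreover have "card {Q, Q'} \<le> card \<Q>"
        using Q fin by (intro card_mono) auto
      ultimately show ?thesis using Q by simp
    qed
    finally show False by simp
  qed
  ultimately have "irredundant_primary_decomposition R A \<Q>"
    using \<Q> unfolding irredundant_primary_decomposition_def dec_def by blast
  then show thesis by (rule that)
qed

section \<open>Associated primes and ideal quotients\<close>

lemma nat_pow_mem_ideal_power:
  assumes "a \<in> A" "a \<in> carrier R"
  shows "a [^] n \<in> ideal_power R A n"
proof (induction n)
  case (Suc n)
  have "a [^] Suc n = a \<otimes> a [^] n"
    using assms nat_pow_Suc2 by blast
  then show ?case
    using assms Suc by (auto intro: ideal_prod.prod)
qed simp

text \<open>The quotient is the term m = 1 of the union, because J^1 is the product of J with the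
  whole ring.\<close>

lemma quotient_subset_saturation:
  assumes "ideal J R"
  shows "ideal_quotient R I J \<subseteq> ideal_saturation R I J"
proof -
  have "ideal_power R J 1 = J"
    using ideal_prod_one[OF assms] by simp
  then show ?thesis
    unfolding ideal_saturation_def by fastforce
qed

text \<open>Among the elements outside \<open>Q\<close> of the intersection \<open>C\<close> of the other components, one
  with \<open>(Q : a)\<close> maximal is annihilated by all of \<open>\<surd>Q\<close> modulo \<open>Q\<close>.\<close>

lemma double_quotient_subset_Ass:
  assumes R: "noetherian_ring R" and P: "P \<in> Ass R I" and J: "J \<subseteq> P"
  shows "ideal_quotient R I (ideal_quotient R I J) \<subseteq> P"
proof -
  obtain \<Q> Q where \<Q>: "irredundant_primary_decomposition R I \<Q>" and Q: "Q \<in> \<Q>" "P = radical R Q"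
    using P unfolding Ass_def by blast
  define C where "C = carrier R \<inter> \<Inter>(\<Q> - {Q})"
  have prim: "primary_ideal Q' R" if "Q' \<in> \<Q>" for Q'
    using \<Q> that unfolding irredundant_primary_decomposition_def by blast
  have I_eq: "I = C \<inter> Q"
    using \<Q> Q unfolding irredundant_primary_decomposition_def C_def by blast
  have nsub: "\<not> C \<subseteq> Q"
    using \<Q> Q unfolding irredundant_primary_decomposition_def C_def by blast
  have idQ: "ideal Q R" using prim Q primary_idealD by blast
  have C_mult: "r \<otimes> c \<in> C" if c: "c \<in> C" "r \<in> carrier R" for r c
  proof -
    have "r \<otimes> c \<in> Q'" if "Q' \<in> \<Q> - {Q}" for Q'
      using that c ideal.I_l_closed[OF primary_idealD[OF prim, of Q']] unfolding C_def by blast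
    then show ?thesis
      using c unfolding C_def by blast
  qed
  define D where "D a = {r \<in> carrier R. r \<otimes> a \<in> Q}" for a
  have C_carr: "C \<subseteq> carrier R" unfolding C_def by blast
  have "\<exists>M\<in>D ` (C - Q). \<forall>B\<in>D ` (C - Q). M \<subseteq> B \<longrightarrow> B = M"
  proof (rule noetherian_ring.exists_maximal_ideal_in[OF R])
    show "D ` (C - Q) \<noteq> {}" using nsub by blast
    fix B assume "B \<in> D ` (C - Q)"
    then obtain c where "B = D c" "c \<in> carrier R" using C_carr by blast
    then show "ideal B R" unfolding D_def using ideal_elem_quotient[OF idQ] by blast
  qed
  then obtain a where a: "a \<in> C" "a \<notin> Q"
    and max: "\<And>c. c \<in> C \<Longrightarrow> c \<notin> Q \<Longrightarrow> D a \<subseteq> D c \<Longrightarrow> D c = D a"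
    by blast
  have a_carr: "a \<in> carrier R" using a C_carr by blast
  have "p \<otimes> a \<in> Q" if p: "p \<in> P" for p
  proof (rule ccontr)
    assume pa: "p \<otimes> a \<notin> Q"
    obtain n :: nat where n: "p [^] n \<in> Q" and p_carr: "p \<in> carrier R"
      using p Q unfolding radical_def by blast
    \<comment> \<open>Maximality forces (Q : pa) = (Q : a). Then p^m a \<notin> Q propagates from m
      to m + 1, which contradicts p^n \<in> Q.\<close>
    have "D a \<subseteq> D (p \<otimes> a)"
    proof
      fix r assume r: "r \<in> D a"
      then have "r \<otimes> (p \<otimes> a) = p \<otimes> (r \<otimes> a)"
        using p_carr a_carr by (simp add: D_def m_lcomm)
      with r p_carr a_carr show "r \<in> D (p \<otimes> a)"
        using ideal.I_l_closed[OF idQ] unfolding D_def by auto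
    qed
    then have eq: "D (p \<otimes> a) = D a"
      using max[of "p \<otimes> a"] C_mult a pa p_carr by blast
    have "p [^] m \<otimes> a \<notin> Q" for m :: nat
    proof (induction m)
      case 0
      then show ?case using a a_carr by simp
    next
      case (Suc m)
      then have "p [^] m \<notin> D (p \<otimes> a)"
        unfolding eq by (simp add: D_def)
      then show ?case
        using p_carr a_carr by (simp add: D_def m_assoc)
    qed
    moreover have "p [^] n \<otimes> a \<in> Q"
      using n a_carr ideal.I_r_closed[OF idQ] by blast
    ultimately show False by blast
  qed
  \<comment> \<open>J \<subseteq> P puts aj into Q, and a \<in> C puts it into the other
    components.\<close>
  then have "a \<otimes> j \<in> I" if "j \<in> J" for j
  proof -
    have "j \<in> carrier R" "j \<otimes> a \<in> Q"
      using that J Q(2) radical_subset_carrier[of R Q] \<open>\<And>p. p \<in> P \<Longrightarrow> p \<otimes> a \<in> Q\<close> by blast+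
    then show ?thesis
      using C_mult[OF a(1)] m_comm[OF a_carr] unfolding I_eq by simp
  qed
  then have a_quot: "a \<in> ideal_quotient R I J"
    using a_carr unfolding ideal_quotient_def by blast
  show ?thesis
  proof
    fix f assume "f \<in> ideal_quotient R I (ideal_quotient R I J)"
    then have f: "f \<in> carrier R" "f \<otimes> a \<in> I"
      using a_quot unfolding ideal_quotient_def by blast+
    \<comment> \<open>The factor outside Q is put first, since \<open>primary_ideal\<close> places
      the second factor in the radical.\<close>
    then have "a \<otimes> f \<in> Q"
      using m_comm[OF f(1) a_carr] unfolding I_eq by simp
    then show "f \<in> P"
      using a(2) f(1) a_carr prim[OF Q(1)] Q(2) unfolding primary_ideal_def by blast
  qed
qed

text \<open>Prime divisors of a radical ideal are minimal over it. The prime \<surd>Q contains a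
  component S of J, so \<surd>S \<subseteq> \<surd>Q \<subseteq> \<surd>T = P. If S differed from T,
  the component T would be redundant because J is radical; hence S = T and the inclusions are
  equalities.\<close>

lemma Ass_radical_minimal:
  assumes J: "radical_ideal J R" and P: "P \<in> Ass R J"
    and Q: "primary_ideal Q R" "J \<subseteq> radical R Q" "radical R Q \<subseteq> P"
  shows "radical R Q = P"
proof -
  obtain \<Q> T where \<Q>: "irredundant_primary_decomposition R J \<Q>" and T: "T \<in> \<Q>" "P = radical R T"
    using P unfolding Ass_def by blast
  have ideals: "ideal T R" if "T \<in> \<Q>" for T
    using \<Q> that primary_idealD unfolding irredundant_primary_decomposition_def by blast
  have J_eq: "J = carrier R \<inter> \<Inter>\<Q>" and fin: "finite \<Q>"
    using \<Q> unfolding irredundant_primary_decomposition_def by blast+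
  have "carrier R \<inter> \<Inter>\<Q> \<subseteq> radical R Q"
    using Q(2) J_eq by simp
  then obtain S where S: "S \<in> \<Q>" "S \<subseteq> radical R Q"
    using Inter_subset_radical_primary[OF Q(1) fin] ideals ideal.Icarr ideal.I_l_closed
    by (metis subsetI)
  then have rad: "radical R S \<subseteq> radical R Q"
    using radical_mono radical_radical by blast
  have "S = T"
  proof (rule ccontr)
    assume "S \<noteq> T"
    have "x \<in> T" if x: "x \<in> carrier R \<inter> \<Inter>(\<Q> - {T})" for x
    proof -
      have "x \<in> S" using x S \<open>S \<noteq> T\<close> by blast
      then have "x \<in> radical R T"
        using subset_radical[OF ideals[OF S(1)]] rad Q(3) T(2) by blast
      then obtain n :: nat where n: "n \<ge> 1" "x [^] n \<in> T"
        unfolding radical_def by blast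
      \<comment> \<open>The power is needed only for T; x itself lies in every other
        component.\<close>
      have "x [^] n \<in> U" if "U \<in> \<Q>" for U
      proof (cases "U = T")
        case True
        with n show ?thesis by simp
      next
        case False
        with x that have "x [^] (1::nat) \<in> U" "x \<in> carrier R" by auto
        then show ?thesis
          using nat_pow_mem_ideal_mono[OF ideals[OF that]] n by blast
      qed
      then have "x \<in> radical R J"
        using n x unfolding J_eq radical_def by auto
      then show ?thesis
        using J T(1) unfolding radical_ideal_def J_eq by blast
    qed
    then show False
      using \<Q> T(1) unfolding irredundant_primary_decomposition_def by blast
  qed
  with rad T Q(3) show ?thesis by blast
qed

text \<open>Every prime divisor of J contains J and is a prime divisor of I, so it contains (I : (I
  : J)); the prime divisors of the radical ideal J intersect in J.\<close>

lemma Ass_subset_imp_double_quotient: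
  assumes R: "noetherian_ring R" and J: "radical_ideal J R"
    and sub: "Ass R J \<subseteq> Ass R I"
  shows "ideal_quotient R I (ideal_quotient R I J) \<subseteq> J"
proof -
  have idJ: "ideal J R" using J unfolding radical_ideal_def by blast
  obtain \<Q> where \<Q>: "irredundant_primary_decomposition R J \<Q>"
    using exists_irredundant_primary_decomposition[OF R idJ] .
  have J_eq: "J = carrier R \<inter> \<Inter>\<Q>" and fin: "finite \<Q>"
    and ideals: "\<And>Q. Q \<in> \<Q> \<Longrightarrow> ideal Q R"
    using \<Q> primary_idealD unfolding irredundant_primary_decomposition_def by blast+
  have J_rad: "\<And>Q. Q \<in> \<Q> \<Longrightarrow> J \<subseteq> radical R Q"
    using subset_radical ideals J_eq by blast
  show ?thesis
  proof
    fix f assume f: "f \<in> ideal_quotient R I (ideal_quotient R I J)"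
    then have f_carr: "f \<in> carrier R"
      unfolding ideal_quotient_def by blast
    have "f \<in> radical R Q" if "Q \<in> \<Q>" for Q
    proof -
      have "radical R Q \<in> Ass R I"
        using sub \<Q> that unfolding Ass_def by blast
      then show ?thesis
        using double_quotient_subset_Ass[OF R _ J_rad[OF that]] f by blast
    qed
    then have "\<forall>Q\<in>\<Q>. \<exists>n::nat. n \<ge> 1 \<and> f [^] n \<in> Q"
      unfolding radical_def by blast
    then obtain e :: "_ \<Rightarrow> nat" where e: "\<And>Q. Q \<in> \<Q> \<Longrightarrow> e Q \<ge> 1 \<and> f [^] e Q \<in> Q"
      by metis
    \<comment> \<open>A common exponent for all components; \<open>Suc\<close> keeps it positive
      even for an empty decomposition.\<close>
    define n where "n = Suc (\<Sum>Q\<in>\<Q>. e Q)"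
    have "f [^] n \<in> Q" if "Q \<in> \<Q>" for Q
    proof -
      have "e Q \<le> n"
        unfolding n_def using member_le_sum[OF that, of e] fin by simp
      then show ?thesis
        using nat_pow_mem_ideal_mono[OF ideals[OF that] f_carr] e[OF that] by blast
    qed
    then have "f [^] n \<in> J"
      unfolding J_eq using f_carr by simp
    then have "f \<in> radical R J"
      using f_carr unfolding radical_def n_def by auto
    then show "f \<in> J"
      using J unfolding radical_ideal_def by blast
  qed
qed

lemma quotient_saturation_imp_Ass_subset:
  assumes R: "noetherian_ring R" and I: "ideal I R" and J: "radical_ideal J R"
    and sub: "ideal_quotient R I (ideal_saturation R I J) \<subseteq> J"
  shows "Ass R J \<subseteq> Ass R I"
proof
  fix P assume P: "P \<in> Ass R J"
  then obtain \<T> T where \<T>: "irredundant_primary_decomposition R J \<T>" and T: "T \<in> \<T>" "P = radical R T"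
    unfolding Ass_def by blast
  have primT: "primary_ideal T R" and "J \<subseteq> T"
    using \<T> T unfolding irredundant_primary_decomposition_def by blast+
  then have JP: "J \<subseteq> P"
    using subset_radical primary_idealD T(2) by blast
  have idJ: "ideal J R" using J unfolding radical_ideal_def by blast
  obtain \<Q> where \<Q>: "irredundant_primary_decomposition R I \<Q>"
    using exists_irredundant_primary_decomposition[OF R I] .
  have prim: "\<And>Q. Q \<in> \<Q> \<Longrightarrow> primary_ideal Q R" and I_eq: "I = carrier R \<inter> \<Inter>\<Q>"
    and fin: "finite \<Q>"
    using \<Q> unfolding irredundant_primary_decomposition_def by blast+
  then have ideals: "\<And>Q. Q \<in> \<Q> \<Longrightarrow> ideal Q R"
    using primary_idealD by blast
  define \<N> where "\<N> = {Q \<in> \<Q>. J \<subseteq> radical R Q}"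
  have sat: "m \<in> Q" if m: "m \<in> ideal_saturation R I J" and Q: "Q \<in> \<Q>" "Q \<notin> \<N>" for m Q
  proof -
    obtain k :: nat where k: "k \<ge> 1" and m_carr: "m \<in> carrier R"
      and mk: "\<And>b. b \<in> ideal_power R J k \<Longrightarrow> m \<otimes> b \<in> I"
      using m unfolding ideal_saturation_def ideal_quotient_def by auto
    obtain j where j: "j \<in> J" "j \<notin> radical R Q"
      using Q unfolding \<N>_def by blast
    have j_carr: "j \<in> carrier R" using j idJ ideal.Icarr by metis
    \<comment> \<open>Since j^k \<in> J^k, the product lies in I \<subseteq> Q; as j^k \<notin>
      \<surd>Q, the primary condition leaves m \<in> Q.\<close>
    have "m \<otimes> j [^] k \<in> Q"
      using mk[OF nat_pow_mem_ideal_power[OF j(1) j_carr]] I_eq Q by blast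
    moreover have "j [^] k \<notin> radical R Q"
      using j j_carr k nat_pow_mem_radical by blast
    ultimately show ?thesis
      using prim[OF Q(1)] m_carr j_carr unfolding primary_ideal_def by blast
  qed
  have sat_carr: "ideal_saturation R I J \<subseteq> carrier R"
    unfolding ideal_saturation_def ideal_quotient_def by blast
  have "carrier R \<inter> \<Inter>\<N> \<subseteq> ideal_quotient R I (ideal_saturation R I J)"
  proof
    fix f assume f: "f \<in> carrier R \<inter> \<Inter>\<N>"
    \<comment> \<open>For Q in \<open>\<N>\<close> the factor f lies in Q; for every other component
      the factor m does.\<close>
    have "f \<otimes> m \<in> Q" if m: "m \<in> ideal_saturation R I J" and Q: "Q \<in> \<Q>" for m Q
    proof (cases "Q \<in> \<N>")
      case True
      with f m sat_carr show ?thesis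
        using ideal.I_r_closed[OF ideals[OF Q]] by blast
    next
      case False
      with f sat[OF m Q] show ?thesis
        using ideal.I_l_closed[OF ideals[OF Q]] by blast
    qed
    with f sat_carr show "f \<in> ideal_quotient R I (ideal_saturation R I J)"
      unfolding ideal_quotient_def I_eq by blast
  qed
  \<comment> \<open>The prime P = \<surd>T contains the intersection over \<open>\<N>\<close>, hence
    a member of \<open>\<N>\<close>; in particular \<open>\<N>\<close> is not empty.\<close>
  with sub JP T(2) have "carrier R \<inter> \<Inter>\<N> \<subseteq> radical R T" by blast
  moreover have "finite \<N>" using fin unfolding \<N>_def by simp
  ultimately obtain Q where Q: "Q \<in> \<N>" "Q \<subseteq> radical R T"
    using Inter_subset_radical_primary[OF primT, of \<N>] ideals ideal.Icarr ideal.I_l_closed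
    unfolding \<N>_def by (metis (no_types, lifting) mem_Collect_eq subsetI)
  then have "radical R Q \<subseteq> P"
    using radical_mono radical_radical T(2) by blast
  then have "radical R Q = P"
    using Ass_radical_minimal[OF J P, of Q] Q(1) prim unfolding \<N>_def by blast
  then show "P \<in> Ass R I"
    using \<Q> Q(1) unfolding Ass_def \<N>_def by blast
qed

end

section \<open>Hilbert's basis theorem\<close>

text \<open>An ideal \<open>I\<close> of \<open>K[X][x]\<close> is determined, among the ideals containing it, by the ideals
  \<open>leading_coeffs X x n I\<close> of \<open>K[X]\<close>, which increase with \<open>n\<close> and with \<open>I\<close>.\<close>

lemma mpoly_ring_simps [simp]:
  "p \<in> carrier (mpoly_ring X) \<longleftrightarrow> (\<forall>m \<in> Poly_Mapping.keys p. Poly_Mapping.keys m \<subseteq> X)"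
  "p \<otimes>\<^bsub>mpoly_ring X\<^esub> q = p * q" "p \<oplus>\<^bsub>mpoly_ring X\<^esub> q = p + q"
  "\<one>\<^bsub>mpoly_ring X\<^esub> = 1" "\<zero>\<^bsub>mpoly_ring X\<^esub> = 0"
  by (simp_all add: mpoly_ring_def)

lemma ideal_mpoly_ringD:
  assumes "ideal I (mpoly_ring X)"
  shows "p \<in> I \<Longrightarrow> p \<in> carrier (mpoly_ring X)" "0 \<in> I" "p \<in> I \<Longrightarrow> q \<in> I \<Longrightarrow> p + q \<in> I"
    "p \<in> I \<Longrightarrow> q \<in> I \<Longrightarrow> p - q \<in> I" "p \<in> I \<Longrightarrow> r \<in> carrier (mpoly_ring X) \<Longrightarrow> r * p \<in> I"
proof -
  show "p \<in> I \<Longrightarrow> p \<in> carrier (mpoly_ring X)"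
    by (rule ideal.Icarr[OF assms])
  show "0 \<in> I"
    using additive_subgroup.zero_closed[OF ideal.axioms(1)[OF assms]] by simp
  show add: "p \<in> I \<Longrightarrow> q \<in> I \<Longrightarrow> p + q \<in> I" for p q
    using additive_subgroup.a_closed[OF ideal.axioms(1)[OF assms], of p q] by simp
  show mult: "p \<in> I \<Longrightarrow> r \<in> carrier (mpoly_ring X) \<Longrightarrow> r * p \<in> I" for p r
    using ideal.I_l_closed[OF assms, of p r] by simp
  show "p \<in> I \<Longrightarrow> q \<in> I \<Longrightarrow> p - q \<in> I"
    using add[of p "- 1 * q"] mult[of q "- 1"] by simp
qed

text \<open>A strict bound avoids assigning a degree to 0: the bound n = 0 singles out the zero
  polynomial, where the induction on the degree in x starts.\<close>

definition deg_less :: "'x \<Rightarrow> nat \<Rightarrow> (('x \<Rightarrow>\<^sub>0 nat) \<Rightarrow>\<^sub>0 'k::field) \<Rightarrow> bool" where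
  "deg_less x n p \<longleftrightarrow> (\<forall>m \<in> Poly_Mapping.keys p. Poly_Mapping.lookup m x < n)"

definition var_pow :: "'x \<Rightarrow> nat \<Rightarrow> (('x \<Rightarrow>\<^sub>0 nat) \<Rightarrow>\<^sub>0 'k::field)" where
  "var_pow x n = Poly_Mapping.single (Poly_Mapping.single x n) 1"

definition leading_coeffs ::
    "'x set \<Rightarrow> 'x \<Rightarrow> nat \<Rightarrow> (('x \<Rightarrow>\<^sub>0 nat) \<Rightarrow>\<^sub>0 'k::field) set \<Rightarrow> (('x \<Rightarrow>\<^sub>0 nat) \<Rightarrow>\<^sub>0 'k) set" where
  "leading_coeffs X x n I =
     {c \<in> carrier (mpoly_ring X). \<exists>g. deg_less x n g \<and> c * var_pow x n + g \<in> I}"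

section \<open>Degrees and leading coefficients in one variable\<close>

lemma deg_less_0 [simp]: "deg_less x n 0"
  by (simp add: deg_less_def)

lemma deg_less_add: "deg_less x n p \<Longrightarrow> deg_less x n q \<Longrightarrow> deg_less x n (p + q)"
  using Poly_Mapping.keys_add[of p q] unfolding deg_less_def by blast

lemma deg_less_minus: "deg_less x n p \<Longrightarrow> deg_less x n q \<Longrightarrow> deg_less x n (p - q)"
  using Poly_Mapping.keys_diff[of p q] unfolding deg_less_def by blast

text \<open>Exponents add. The first bound, read as degree at most k, compensates for adding two
  strict bounds.\<close>

lemma deg_less_mult:
  assumes "deg_less x (Suc k) p" "deg_less x n q"
  shows "deg_less x (k + n) (p * q)"
  unfolding deg_less_def
proof
  fix m assume "m \<in> Poly_Mapping.keys (p * q)"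
  then obtain a b where "a \<in> Poly_Mapping.keys p" "b \<in> Poly_Mapping.keys q" "m = a + b"
    using keys_mult[of p q] by blast
  then show "Poly_Mapping.lookup m x < k + n"
    using assms unfolding deg_less_def by (fastforce simp: lookup_add)
qed

lemma deg_less_carrier:
  assumes "x \<notin> X" "p \<in> carrier (mpoly_ring X)"
  shows "deg_less x (Suc 0) p"
  unfolding deg_less_def
proof
  fix m assume "m \<in> Poly_Mapping.keys p"
  then have "x \<notin> Poly_Mapping.keys m" using assms by auto
  then show "Poly_Mapping.lookup m x < Suc 0" by (simp add: in_keys_iff)
qed

lemma var_pow_carrier: "x \<in> X \<Longrightarrow> var_pow x n \<in> carrier (mpoly_ring X)"
  by (simp add: var_pow_def)

lemma var_pow_Suc: "var_pow x 1 * var_pow x n = var_pow x (Suc n)"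
  by (simp add: var_pow_def mult_single flip: single_add)

text \<open>The monomials in which x has exponent exactly n are divided by x^n and form c; the
  others form g.\<close>

lemma split_leading_coeff:
  fixes p :: "('x \<Rightarrow>\<^sub>0 nat) \<Rightarrow>\<^sub>0 'k::field"
  assumes "p \<in> carrier (mpoly_ring (insert x X))" "deg_less x (Suc n) p"
  obtains c g where "c \<in> carrier (mpoly_ring X)" "deg_less x n g" "p = c * var_pow x n + g"
proof -
  let ?s = "\<lambda>m. Poly_Mapping.single m (Poly_Mapping.lookup p m)"
  define A where "A = {m \<in> Poly_Mapping.keys p. Poly_Mapping.lookup m x = n}"
  define c where
    "c = (\<Sum>m\<in>A. Poly_Mapping.single (m - Poly_Mapping.single x n) (Poly_Mapping.lookup p m))"
  define g where "g = (\<Sum>m\<in>Poly_Mapping.keys p - A. ?s m)"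
  have "c \<in> carrier (mpoly_ring X)"
  proof -
    have "Poly_Mapping.keys (m - Poly_Mapping.single x n) \<subseteq> X" if "m \<in> A" for m
    proof
      fix y assume y: "y \<in> Poly_Mapping.keys (m - Poly_Mapping.single x n)"
      then have "y \<noteq> x"
        using that by (auto simp: A_def in_keys_iff lookup_minus)
      moreover have "y \<in> Poly_Mapping.keys m"
        using y by (auto simp: in_keys_iff lookup_minus)
      ultimately show "y \<in> X"
        using that assms(1) by (auto simp: A_def)
    qed
    moreover have "Poly_Mapping.keys c \<subseteq> (\<lambda>m. m - Poly_Mapping.single x n) ` A"
      unfolding c_def
      by (rule order.trans[OF Poly_Mapping.keys_sum]) (auto split: if_splits)
    ultimately show ?thesis unfolding mpoly_ring_simps by blast
  qed
  moreover have "deg_less x n g"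
  proof -
    have "Poly_Mapping.keys g \<subseteq> Poly_Mapping.keys p - A"
      unfolding g_def
      by (rule order.trans[OF Poly_Mapping.keys_sum]) (auto split: if_splits)
    then show ?thesis
      using assms(2) unfolding deg_less_def A_def by fastforce
  qed
  moreover have "p = c * var_pow x n + g"
  proof -
    \<comment> \<open>The truncated subtraction is reversible because the exponent of x in m is
      n.\<close>
    have "m - Poly_Mapping.single x n + Poly_Mapping.single x n = m" if "m \<in> A" for m
      using that
      by (intro poly_mapping_eqI) (auto simp: A_def lookup_add lookup_minus lookup_single when_def)
    then have "c * var_pow x n = (\<Sum>m\<in>A. ?s m)"
      by (simp add: c_def var_pow_def sum_distrib_right mult_single)
    also have "\<dots> + g = (\<Sum>m\<in>Poly_Mapping.keys p. ?s m)"
      unfolding g_def using sum.subset_diff[of A "Poly_Mapping.keys p" ?s]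
      by (simp add: A_def add.commute)
    also have "\<dots> = p"
      by (intro poly_mapping_eqI)
        (auto simp: lookup_sum lookup_single when_def in_keys_iff)
    finally show ?thesis by simp
  qed
  ultimately show thesis by (rule that)
qed

text \<open>Sums and multiples are formed on the witnesses in I; since x \<notin> X, a factor from
  K[X] does not raise the degree in x.\<close>

lemma ideal_leading_coeffs:
  assumes I: "ideal I (mpoly_ring (insert x X))" and x: "x \<notin> X"
  shows "ideal (leading_coeffs X x n I) (mpoly_ring X)"
proof (rule cring.cring_idealI[OF cring_mpoly_ring])
  note D = ideal_mpoly_ringD[OF I]
  show "leading_coeffs X x n I \<subseteq> carrier (mpoly_ring X)"
    unfolding leading_coeffs_def by blast
  show "\<zero>\<^bsub>mpoly_ring X\<^esub> \<in> leading_coeffs X x n I"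
    unfolding leading_coeffs_def using D(2) by (auto intro!: exI[of _ 0])
  fix c assume "c \<in> leading_coeffs X x n I"
  then obtain g where c: "c \<in> carrier (mpoly_ring X)" "deg_less x n g" "c * var_pow x n + g \<in> I"
    unfolding leading_coeffs_def by blast
  {
    fix d assume "d \<in> leading_coeffs X x n I"
    then obtain h where d: "d \<in> carrier (mpoly_ring X)" "deg_less x n h" "d * var_pow x n + h \<in> I"
      unfolding leading_coeffs_def by blast
    have "(c + d) * var_pow x n + (g + h) \<in> I"
      using D(3)[OF c(3) d(3)] by (simp add: algebra_simps)
    moreover have "c + d \<in> carrier (mpoly_ring X)"
      using keys_mpoly_add[of c X d] c d by simp
    ultimately show "c \<oplus>\<^bsub>mpoly_ring X\<^esub> d \<in> leading_coeffs X x n I"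
      unfolding leading_coeffs_def using deg_less_add[OF c(2) d(2)] by auto
  next
    fix r :: "('a \<Rightarrow>\<^sub>0 nat) \<Rightarrow>\<^sub>0 'b" assume r: "r \<in> carrier (mpoly_ring X)"
    then have "r \<in> carrier (mpoly_ring (insert x X))" by auto
    from D(5)[OF c(3) this] have "r * c * var_pow x n + r * g \<in> I"
      by (simp add: algebra_simps)
    moreover have "deg_less x n (r * g)"
      using deg_less_mult[OF deg_less_carrier[OF x r] c(2)] by simp
    moreover have "r * c \<in> carrier (mpoly_ring X)"
      using keys_mpoly_mult[of r X c] r c by simp
    ultimately show "r \<otimes>\<^bsub>mpoly_ring X\<^esub> c \<in> leading_coeffs X x n I"
      unfolding leading_coeffs_def by auto
  }
qed

lemma leading_coeffs_mono: "I \<subseteq> I' \<Longrightarrow> leading_coeffs X x n I \<subseteq> leading_coeffs X x n I'"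
  unfolding leading_coeffs_def by blast

text \<open>Multiplication by x raises the degree by one and keeps the leading coefficient.\<close>

lemma leading_coeffs_mono_exponent:
  assumes I: "ideal I (mpoly_ring (insert x X))" and "n \<le> n'"
  shows "leading_coeffs X x n I \<subseteq> leading_coeffs X x n' I"
proof (rule lift_Suc_mono_le[where f = "\<lambda>n. leading_coeffs X x n I", OF _ \<open>n \<le> n'\<close>])
  fix n
  show "leading_coeffs X x n I \<subseteq> leading_coeffs X x (Suc n) I"
  proof
    fix c assume "c \<in> leading_coeffs X x n I"
    then obtain g where c: "c \<in> carrier (mpoly_ring X)" "deg_less x n g" "c * var_pow x n + g \<in> I"
      unfolding leading_coeffs_def by blast
    have "var_pow x 1 * (c * var_pow x n + g) \<in> I"
      by (rule ideal_mpoly_ringD(5)[OF I c(3) var_pow_carrier]) simp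
    also have "var_pow x 1 * (c * var_pow x n + g) = c * var_pow x (Suc n) + var_pow x 1 * g"
      unfolding var_pow_Suc[symmetric] by (simp add: algebra_simps)
    finally have "c * var_pow x (Suc n) + var_pow x 1 * g \<in> I" .
    moreover have "deg_less x (Suc n) (var_pow x 1 * g)"
      using deg_less_mult[of x 1 "var_pow x 1" n g] c(2) by (simp add: deg_less_def var_pow_def)
    ultimately show "c \<in> leading_coeffs X x (Suc n) I"
      unfolding leading_coeffs_def using c(1) by blast
  qed
qed

text \<open>Induction on the degree bound: from p \<in> I' subtract an element of I with the same
  coefficient of x^n; the difference lies in I' and has smaller degree.\<close>

lemma ideal_subset_if_leading_coeffs_subset:
  assumes I: "ideal I (mpoly_ring (insert x X))" and I': "ideal I' (mpoly_ring (insert x X))"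
    and "I \<subseteq> I'" and lead: "\<And>n. leading_coeffs X x n I' \<subseteq> leading_coeffs X x n I"
  shows "I' \<subseteq> I"
proof
  have "p \<in> I" if "deg_less x n p" "p \<in> I'" for n p
    using that
  proof (induction n arbitrary: p)
    case 0
    then have "p = 0" by (simp add: deg_less_def)
    then show ?case using ideal_mpoly_ringD(2)[OF I] by simp
  next
    case (Suc n)
    obtain c g where c: "c \<in> carrier (mpoly_ring X)" "deg_less x n g" "p = c * var_pow x n + g"
      using split_leading_coeff[OF ideal_mpoly_ringD(1)[OF I' Suc.prems(2)] Suc.prems(1)] .
    then have "c \<in> leading_coeffs X x n I"
      using Suc.prems(2) lead unfolding leading_coeffs_def by blast
    then obtain h where h: "deg_less x n h" "c * var_pow x n + h \<in> I"
      unfolding leading_coeffs_def by blast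
    have "p - (c * var_pow x n + h) \<in> I'"
      using ideal_mpoly_ringD(4)[OF I' Suc.prems(2)] h(2) \<open>I \<subseteq> I'\<close> by blast
    then have "g - h \<in> I"
      using Suc.IH[of "g - h"] deg_less_minus[OF c(2) h(1)] c(3) by simp
    then show ?case
      using ideal_mpoly_ringD(3)[OF I h(2)] c(3) by (fastforce simp: algebra_simps)
  qed
  moreover fix p assume "p \<in> I'"
  moreover have "\<exists>n. deg_less x n p"
  proof -
    have "finite ((\<lambda>m. Poly_Mapping.lookup m x) ` Poly_Mapping.keys p)" by simp
    then show ?thesis
      unfolding deg_less_def finite_nat_set_iff_bounded by blast
  qed
  ultimately show "p \<in> I" by blast
qed

text \<open>Without variables there are only constants, so a nonzero ideal contains an invertible
  element and is the whole ring.\<close>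

lemma noetherian_mpoly_ring_empty:
  "noetherian_ring (mpoly_ring {} :: (('x \<Rightarrow>\<^sub>0 nat) \<Rightarrow>\<^sub>0 'k::field) ring)" (is "noetherian_ring ?R")
proof (rule ring.noetherian_ringI)
  show "ring ?R" using cring_mpoly_ring cring.axioms(1) by blast
  then interpret ring ?R .
  fix I assume I: "ideal I ?R"
  show "\<exists>A\<subseteq>carrier ?R. finite A \<and> I = Idl\<^bsub>?R\<^esub> A"
  proof (cases "I \<subseteq> {0}")
    case True
    then have "I = {\<zero>\<^bsub>?R\<^esub>}" using ideal_mpoly_ringD(2)[OF I] by auto
    then have "I = Idl\<^bsub>?R\<^esub> {\<zero>\<^bsub>?R\<^esub>}"
      using genideal_zero by simp
    then show ?thesis by (intro exI[of _ "{\<zero>\<^bsub>?R\<^esub>}"]) simp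
  next
    case False
    then obtain p where p: "p \<in> I" "p \<noteq> 0" by blast
    then have keys: "Poly_Mapping.keys p \<subseteq> {0}"
      using ideal_mpoly_ringD(1)[OF I p(1)] by auto
    define a where "a = Poly_Mapping.lookup p 0"
    have p_eq: "p = Poly_Mapping.single 0 a"
      using keys by (intro poly_mapping_eqI) (auto simp: a_def lookup_single when_def in_keys_iff)
    then have "a \<noteq> 0" using p by auto
    then have "Poly_Mapping.single 0 (inverse a) * p = 1"
      by (simp add: p_eq mult_single)
    moreover have "Poly_Mapping.single 0 (inverse a) * p \<in> I"
      by (rule ideal_mpoly_ringD(5)[OF I p(1)]) simp
    ultimately have "I = carrier ?R"
      using ideal.one_imp_carrier[OF I] by simp
    then have "I = Idl\<^bsub>?R\<^esub> {\<one>\<^bsub>?R\<^esub>}"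
      using genideal_one by simp
    then show ?thesis by (intro exI[of _ "{\<one>\<^bsub>?R\<^esub>}"]) simp
  qed
qed

text \<open>A chain of ideals is shown to contain its union U, by finding a member with the same
  leading coefficients as U in every degree. Stabilisation at N leaves only finitely many degrees to
  match.\<close>

lemma noetherian_mpoly_ring_insert:
  fixes X :: "'x set"
  assumes N: "noetherian_ring (mpoly_ring X :: (('x \<Rightarrow>\<^sub>0 nat) \<Rightarrow>\<^sub>0 'k::field) ring)" and x: "x \<notin> X"
  shows "noetherian_ring (mpoly_ring (insert x X) :: (('x \<Rightarrow>\<^sub>0 nat) \<Rightarrow>\<^sub>0 'k) ring)"
    (is "noetherian_ring ?R")
proof (rule ring.trivial_ideal_chain_imp_noetherian)
  show "ring ?R" using cring_mpoly_ring cring.axioms(1) by blast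
  then interpret ring ?R .
  fix \<C> assume "\<C> \<noteq> {}" and chain: "subset.chain {I. ideal I ?R} \<C>"
  define U where "U = \<Union>\<C>"
  let ?L = "leading_coeffs X x"
  have ideals: "\<And>I. I \<in> \<C> \<Longrightarrow> ideal I ?R"
    using chain unfolding pred_on.chain_def by blast
  have U: "ideal U ?R"
    using chain_Union_is_ideal[OF chain] \<open>\<C> \<noteq> {}\<close> unfolding U_def by simp
  have "\<exists>M\<in>range (\<lambda>n. ?L n U). \<forall>A\<in>range (\<lambda>n. ?L n U). M \<subseteq> A \<longrightarrow> A = M"
    by (rule noetherian_ring.exists_maximal_ideal_in[OF N]) (auto intro: ideal_leading_coeffs[OF U x])
  then obtain N where N_max: "\<And>n. ?L N U \<subseteq> ?L n U \<Longrightarrow> ?L n U = ?L N U"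
    by auto
  \<comment> \<open>For fixed n the leading coefficient ideals of the members form a chain in the
    Noetherian ring K[X], so their union is attained.\<close>
  have "\<exists>I\<in>\<C>. ?L n I = ?L n U" for n
  proof -
    have "subset.chain {I. ideal I (mpoly_ring X)} (?L n ` \<C>)"
      unfolding pred_on.chain_def
    proof (intro conjI ballI subsetI)
      fix A assume "A \<in> ?L n ` \<C>"
      then obtain I where "I \<in> \<C>" "A = ?L n I" by blast
      then show "A \<in> {I. ideal I (mpoly_ring X)}"
        using ideal_leading_coeffs[OF ideals x] by simp
    next
      fix A B assume "A \<in> ?L n ` \<C>" "B \<in> ?L n ` \<C>"
      then obtain I I' where "I \<in> \<C>" "I' \<in> \<C>" "A = ?L n I" "B = ?L n I'" by blast
      moreover from this have "I \<subseteq> I' \<or> I' \<subseteq> I"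
        using chain unfolding pred_on.chain_def by blast
      ultimately have "A \<subseteq> B \<or> B \<subseteq> A"
        by (auto dest: leading_coeffs_mono)
      then show "(\<subset>)\<^sup>=\<^sup>= A B \<or> (\<subset>)\<^sup>=\<^sup>= B A"
        by blast
    qed
    then have "\<Union>(?L n ` \<C>) \<in> ?L n ` \<C>"
      by (intro noetherian_ring.ideal_chain_is_trivial[OF N]) (use \<open>\<C> \<noteq> {}\<close> in simp)
    moreover have "\<Union>(?L n ` \<C>) = ?L n U"
      unfolding leading_coeffs_def U_def by auto
    ultimately show ?thesis by auto
  qed
  then obtain F where F: "\<And>n. F n \<in> \<C>" "\<And>n. ?L n (F n) = ?L n U"
    by metis
  \<comment> \<open>Finitely many members of a chain lie in a common member.\<close>
  have "\<exists>I\<in>\<C>. \<forall>n\<le>k. F n \<subseteq> I" for k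
  proof (induction k)
    case 0
    then show ?case using F(1) by auto
  next
    case (Suc k)
    then obtain I where I: "I \<in> \<C>" "\<forall>n\<le>k. F n \<subseteq> I" by blast
    have "I \<subseteq> F (Suc k) \<or> F (Suc k) \<subseteq> I"
      using chain I(1) F(1)[of "Suc k"] unfolding pred_on.chain_def by blast
    then show ?case
    proof
      assume "I \<subseteq> F (Suc k)"
      with I have "\<forall>n\<le>Suc k. F n \<subseteq> F (Suc k)" by (auto simp: le_Suc_eq)
      then show ?case using F(1) by blast
    next
      assume "F (Suc k) \<subseteq> I"
      with I have "\<forall>n\<le>Suc k. F n \<subseteq> I" by (auto simp: le_Suc_eq)
      then show ?case using I(1) by blast
    qed
  qed
  then obtain I where I: "I \<in> \<C>" "\<And>n. n \<le> N \<Longrightarrow> F n \<subseteq> I" by blast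
  have low: "?L n U \<subseteq> ?L n I" if "n \<le> N" for n
    using leading_coeffs_mono[OF I(2)[OF that]] F(2) by blast
  have "?L n U \<subseteq> ?L n I" for n
  proof (cases "n \<le> N")
    case False
    then have "N \<le> n" by simp
    \<comment> \<open>Beyond N nothing new appears in U, and the coefficients matched at N persist
      in I.\<close>
    have "?L n U = ?L N U"
      by (rule N_max[OF leading_coeffs_mono_exponent[OF U \<open>N \<le> n\<close>]])
    also have "\<dots> \<subseteq> ?L N I" by (rule low) simp
    also have "\<dots> \<subseteq> ?L n I"
      by (rule leading_coeffs_mono_exponent[OF ideals[OF I(1)] \<open>N \<le> n\<close>])
    finally show ?thesis .
  qed (rule low)
  moreover have "I \<subseteq> U" using I(1) unfolding U_def by blast
  ultimately have "I = U"
    using ideal_subset_if_leading_coeffs_subset[OF ideals[OF I(1)] U] by blast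
  then show "\<Union>\<C> \<in> \<C>" using I(1) unfolding U_def by simp
qed

theorem noetherian_mpoly_ring:
  assumes "finite X"
  shows "noetherian_ring (mpoly_ring X :: (('x \<Rightarrow>\<^sub>0 nat) \<Rightarrow>\<^sub>0 'k::field) ring)"
  using assms
proof induction
  case empty
  show ?case by (rule noetherian_mpoly_ring_empty)
next
  case (insert x X)
  show ?case by (rule noetherian_mpoly_ring_insert[OF insert.IH insert.hyps(2)])
qed

section \<open>Associated primes of radical ideals of a polynomial ring\<close>

theorem theorem2p1p4:
  fixes X :: "'x set" and I J :: "(('x \<Rightarrow>\<^sub>0 nat) \<Rightarrow>\<^sub>0 'k::field) set"
  assumes "finite X"
    and "ideal I (mpoly_ring X)"
    and "radical_ideal J (mpoly_ring X)"
    and "J \<noteq> carrier (mpoly_ring X)"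
  shows "(Ass (mpoly_ring X) J \<subseteq> Ass (mpoly_ring X) I \<longleftrightarrow>
            ideal_quotient (mpoly_ring X) I (ideal_quotient (mpoly_ring X) I J) \<subseteq> J) \<and>
         (ideal_quotient (mpoly_ring X) I (ideal_quotient (mpoly_ring X) I J) \<subseteq> J \<longleftrightarrow>
            ideal_quotient (mpoly_ring X) I (ideal_saturation (mpoly_ring X) I J) \<subseteq> J)"
    (is "(?A \<longleftrightarrow> ?B) \<and> (?B \<longleftrightarrow> ?C)")
proof -
  note cring = cring_mpoly_ring[where X = X and 'k = 'k]
  have R: "noetherian_ring (mpoly_ring X :: (('x \<Rightarrow>\<^sub>0 nat) \<Rightarrow>\<^sub>0 'k) ring)"
    using assms(1) by (rule noetherian_mpoly_ring)
  have "ideal J (mpoly_ring X)"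
    using assms(3) unfolding radical_ideal_def by blast
  \<comment> \<open>Passing from (I : J) to the larger saturation shrinks the outer quotient. This
    closes the cycle through (A), (B) and (C).\<close>
  then have "?B \<Longrightarrow> ?C"
    using ideal_quotient_antimono[OF cring.quotient_subset_saturation[OF cring]] by blast
  moreover have "?A \<Longrightarrow> ?B"
    by (rule cring.Ass_subset_imp_double_quotient[OF cring R assms(3)])
  moreover have "?C \<Longrightarrow> ?A"
    by (rule cring.quotient_saturation_imp_Ass_subset[OF cring R assms(2,3)])
  ultimately show ?thesis by blast
qed

end
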